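(* Let $k_1,k_2\ge1$ be integers. For all $n\ge k_1$, $$P_{q,\theta}\big(L_n^{(1)}\ge k_1,\ L_n^{(0)}\le k_2\big)=\mathbf J(n,k_1+1)\sum_{i=1}^{n-k_1}\theta^{n-i}\prod_{j=1}^{i}(1-\theta q^{j-1})\sum_{s=1}^{i}\Big[H_{q,k_1,0}^{\infty,k_2+1}(n-i,i,s)+O_{q,k_1,0}^{\infty,k_2+1}(n-i,i,s)+G_{q,k_1,0}^{\infty,k_2+1}(n-i,i,s+1)+P_{q,k_1,0}^{\infty,k_2+1}(n-i,i,s)\Big]+\mathbf J(n,k_1)\theta^n,$$ where $\mathbf J(n,k)=1$ if $n\ge k$ and $\mathbf J(n,k)=0$ otherwise.
   Context: Model: fix reals $0\le\theta\le1$ and $0<q<1$. $(X_j)_{j\ge1}$ is a sequence of $\{0,1\}$-valued random variables (1 = success, 0 = failure) with law $P_{q,\theta}$ such that, conditionally on $X_1,\dots,X_{j-1}$ containing exactly $i-1$ zeros, $X_j=0$ with probability $1-\theta q^{i-1}$ and $X_j=1$ with probability $\theta q^{i-1}$. Conventions: $0^0=1$, empty products are 1, empty sums are 0. $L_n^{(1)}$ and $L_n^{(0)}$ are the lengths of the longest run of consecutive successes and of consecutive failures, respectively, in $X_1,\dots,X_n$ ($0$ if there is none). $S_{r,s}^{k}$ denotes the set of $s$-tuples of positive integers with sum $r$ and maximum $>k$ (for $k=0$ the maximum condition is vacuous, and $S_{0,0}^0$ consists of the empty tuple). Combinatorial sums, for a positive integer $\kappa$ (second superscript), integers $m,r$ and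 $s\ge1$: - $G_{q,k_1,0}^{\infty,\kappa}(m,r,s)=\sum q^{\sum_{j=2}^{s}(y_1+\dots+y_{j-1})x_j}$ over $(x_1,\dots,x_s)\in S_{m,s}^{k_1-1}$ and $(y_1,\dots,y_{s-1})\in S_{r,s-1}^0$ with all $y_j<\kappa$; - $H_{q,k_1,0}^{\infty,\kappa}(m,r,s)=\sum q^{\sum_{j=1}^{s}(y_1+\dots+y_j)x_j}$ over $(x_1,\dots,x_s)\in S_{m,s}^{k_1-1}$ and $(y_1,\dots,y_s)\in S_{r,s}^0$ with all $y_j<\kappa$; - $O_{q,k_1,0}^{\infty,\kappa}(m,r,s)=\sum q^{\sum_{j=1}^{s-1}(y_1+\dots+y_j)x_j}$ over $(x_1,\dots,x_{s-1})\in S_{m,s-1}^{k_1-1}$ and $(y_1,\dots,y_s)\in S_{r,s}^0$ with all $y_j<\kappa$; - $P_{q,k_1,0}^{\infty,\kappa}(m,r,s)=\sum q^{\sum_{j=2}^{s}(y_1+\dots+y_{j-1})x_j}$ over $(x_1,\dots,x_s)\in S_{m,s}^{k_1-1}$ and $(y_1,\dots,y_s)\in S_{r,s}^0$ with all $y_j<\kappa$. *)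

theory Defs
  imports "HOL-Probability.Probability"
begin

text \<open>
  The trials are indexed from 1; \<open>X 0\<close> plays no role. The law is specified by conditioning
  on the full history \<open>X 1 = x 1, \<dots>, X (j - 1) = x (j - 1)\<close>: the conditional distribution of
  \<open>X j\<close> depends on that history only through its number \<open>i - 1\<close> of zeros. Histories of
  probability zero are excluded, since \<open>cond_prob\<close> is then a division by zero.
\<close>

locale q_success_process = prob_space M for M :: "'a measure" +
  fixes q \<theta> :: real and X :: "nat \<Rightarrow> 'a \<Rightarrow> nat"
  assumes binary_valued: "\<And>j. j \<ge> 1 \<Longrightarrow> X j \<in> measurable M (count_space {0, 1})"
    and cond_failure:
      "\<And>j i x. \<lbrakk> j \<ge> 1; i \<ge> 1; card {l \<in> {1..<j}. x l = 0} = i - 1;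
          \<P>(\<omega> in M. \<forall>l\<in>{1..<j}. X l \<omega> = x l) > 0 \<rbrakk> \<Longrightarrow>
        \<P>(\<omega> in M. X j \<omega> = 0 \<bar> \<forall>l\<in>{1..<j}. X l \<omega> = x l) = 1 - \<theta> * q ^ (i - 1)"
    and cond_success:
      "\<And>j i x. \<lbrakk> j \<ge> 1; i \<ge> 1; card {l \<in> {1..<j}. x l = 0} = i - 1;
          \<P>(\<omega> in M. \<forall>l\<in>{1..<j}. X l \<omega> = x l) > 0 \<rbrakk> \<Longrightarrow>
        \<P>(\<omega> in M. X j \<omega> = 1 \<bar> \<forall>l\<in>{1..<j}. X l \<omega> = x l) = \<theta> * q ^ (i - 1)"

text \<open>
  Length of the longest run of the value \<open>b\<close> in \<open>x 1, \<dots>, x n\<close>. The case \<open>l = 0\<close> always belongs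
  to the set, so the maximum is 0 when \<open>b\<close> does not occur.
\<close>

definition longest_run :: "nat \<Rightarrow> nat \<Rightarrow> (nat \<Rightarrow> nat) \<Rightarrow> nat" where
  "longest_run b n x = Max {l. \<exists>a. a + l \<le> n \<and> (\<forall>j\<in>{a+1..a+l}. x j = b)}"

text \<open>
  \<open>tuples r s k\<close> is the set $S_{r,s}^k$; tuples are lists, so the entry $x_j$ is \<open>xs ! (j - 1)\<close>
  and $y_1 + \dots + y_j$ is \<open>sum_list (take j ys)\<close>.
\<close>

definition tuples :: "nat \<Rightarrow> nat \<Rightarrow> nat \<Rightarrow> nat list set" where
  "tuples r s k = {xs. length xs = s \<and> sum_list xs = r \<and> (\<forall>x\<in>set xs. x > 0) \<and>
                       (k = 0 \<or> (\<exists>x\<in>set xs. x > k))}"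

lemma finite_tuples: "finite (tuples r s k)"
proof (rule finite_subset)
  show "tuples r s k \<subseteq> {xs. set xs \<subseteq> {..r} \<and> length xs = s}"
    by (auto simp: tuples_def dest: member_le_sum_list)
  show "finite {xs. set xs \<subseteq> {..r} \<and> length xs = s}"
    by (rule finite_lists_length_eq) simp
qed

definition tuples_below :: "nat \<Rightarrow> nat \<Rightarrow> nat \<Rightarrow> nat list set" where
  "tuples_below \<kappa> r s = {ys \<in> tuples r s 0. \<forall>y\<in>set ys. y < \<kappa>}"

definition G_sum :: "real \<Rightarrow> nat \<Rightarrow> nat \<Rightarrow> nat \<Rightarrow> nat \<Rightarrow> nat \<Rightarrow> real" where
  "G_sum q k1 \<kappa> m r s =
     (\<Sum>(xs, ys) \<in> tuples m s (k1 - 1) \<times> tuples_below \<kappa> r (s - 1).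
        q ^ (\<Sum>j=2..s. sum_list (take (j - 1) ys) * xs ! (j - 1)))"

definition H_sum :: "real \<Rightarrow> nat \<Rightarrow> nat \<Rightarrow> nat \<Rightarrow> nat \<Rightarrow> nat \<Rightarrow> real" where
  "H_sum q k1 \<kappa> m r s =
     (\<Sum>(xs, ys) \<in> tuples m s (k1 - 1) \<times> tuples_below \<kappa> r s.
        q ^ (\<Sum>j=1..s. sum_list (take j ys) * xs ! (j - 1)))"

definition O_sum :: "real \<Rightarrow> nat \<Rightarrow> nat \<Rightarrow> nat \<Rightarrow> nat \<Rightarrow> nat \<Rightarrow> real" where
  "O_sum q k1 \<kappa> m r s =
     (\<Sum>(xs, ys) \<in> tuples m (s - 1) (k1 - 1) \<times> tuples_below \<kappa> r s.
        q ^ (\<Sum>j=1..s-1. sum_list (take j ys) * xs ! (j - 1)))"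

definition P_sum :: "real \<Rightarrow> nat \<Rightarrow> nat \<Rightarrow> nat \<Rightarrow> nat \<Rightarrow> nat \<Rightarrow> real" where
  "P_sum q k1 \<kappa> m r s =
     (\<Sum>(xs, ys) \<in> tuples m s (k1 - 1) \<times> tuples_below \<kappa> r s.
        q ^ (\<Sum>j=2..s. sum_list (take (j - 1) ys) * xs ! (j - 1)))"

definition J_ind :: "nat \<Rightarrow> nat \<Rightarrow> real" where
  "J_ind n k = (if n \<ge> k then 1 else 0)"

end

theory Submission
  imports Defs
begin

text \<open>
  Encode the outcome of the first \<open>n\<close> trials as a word over \<open>bool\<close>, with \<open>True\<close> for success.
  A success that has \<open>z\<close> failures before it contributes the factor \<open>\<theta> q\<^sup>z\<close>, and the \<open>j\<close>-th failure
  contributes \<open>1 - \<theta> q\<^sup>j\<^sup>-\<^sup>1\<close>, wherever it stands. Hence the probability of a word depends only on its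
  numbers of successes and failures and on its number of pairs (failure, later success), the
  exponent of \<open>q\<close> (\<open>prob_path_event\<close>).

  A nonempty word is the same thing as its first letter together with the lengths \<open>xs\<close> of its success
  runs and \<open>ys\<close> of its failure runs; since the two kinds of run alternate, the lengths of these
  lists differ by at most one, with the surplus on the side of the first letter
  (\<open>alternating_word_runs\<close>, \<open>runs_alternating_word\<close>). Both longest runs can be read off \<open>xs\<close> and
  \<open>ys\<close>, and so can the exponent of \<open>q\<close>: each success in the \<open>j\<close>-th success run is preceded by all
  failures of the failure runs before it, which gives the exponents \<open>\<Sum> (y\<^sub>1 + \<dots>) x\<^sub>j\<close>
  (\<open>inversions_alternating_word\<close>).

  It remains to add up the words with \<open>i \<ge> 1\<close> failures in \<open>s\<close> failure runs. They begin and end in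
  four possible ways: failure to success gives \<open>H\<close>, failure to failure \<open>O\<close>, success to success
  \<open>G\<close> (with \<open>s + 1\<close> success runs), and success to failure \<open>P\<close> (\<open>sum_good_words\<close>). The only word
  without failures is \<open>True\<dots>True\<close>, of probability \<open>\<theta>\<^sup>n\<close>. A success run of length \<open>k1\<close> leaves room
  for at most \<open>n - k1\<close> failures.
\<close>

section \<open>Words and their runs\<close>

function runs :: "'a \<Rightarrow> 'a list \<Rightarrow> nat list" where
  "runs c [] = []"
| "runs c (d # w) =
    (if d = c then Suc (length (takeWhile (\<lambda>e. e = c) w)) # runs c (dropWhile (\<lambda>e. e = c) w)
     else runs c w)"
  by pat_completeness auto
termination
  by (relation "Wellfounded.measure (\<lambda>(c, w). length w)") (auto simp: le_imp_less_Suc length_dropWhile_le)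

text \<open>
  The two letters swap roles in the recursive call, so \<open>us\<close> always lists the runs of \<open>b\<close>, the letter
  with which the word begins. A surplus in \<open>vs\<close> is silently discarded.
\<close>
function alternating_word :: "bool \<Rightarrow> nat list \<Rightarrow> nat list \<Rightarrow> bool list" where
  "alternating_word b [] vs = []"
| "alternating_word b (u # us) vs = replicate u b @ alternating_word (\<not> b) vs us"
  by pat_completeness auto
termination by (relation "Wellfounded.measure (\<lambda>(b, us, vs). length us + length vs)") auto

lemma length_eq_count_list:
  "length w = count_list w True + count_list w False" for w :: "bool list"
  by (induction w) auto

lemma runs_replicate_same:
  assumes "m > 0" "w = [] \<or> hd w \<noteq> c"
  shows "runs c (replicate m c @ w) = m # runs c w"
proof -
  obtain m' where m: "m = Suc m'" using assms(1) by (cases m) auto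
  have "takeWhile (\<lambda>e. e = c) w = []" "dropWhile (\<lambda>e. e = c) w = w"
    using assms(2) by (cases w; simp)+
  then show ?thesis unfolding m by (simp add: takeWhile_append dropWhile_append)
qed

lemma runs_replicate_other: "d \<noteq> c \<Longrightarrow> runs c (replicate m d @ w) = runs c w"
  by (induction m) auto

lemma runs_pos: "r \<in> set (runs c w) \<Longrightarrow> r > 0"
  by (induction c w rule: runs.induct) (auto split: if_splits)

lemma sum_list_runs: "sum_list (runs c w) = count_list w c"
proof (induction c w rule: runs.induct)
  case (2 c d w)
  have "count_list w c = count_list (takeWhile (\<lambda>e. e = c) w) c + count_list (dropWhile (\<lambda>e. e = c) w) c"
    by (metis count_list_append takeWhile_dropWhile_id)
  moreover have "count_list (takeWhile (\<lambda>e. e = c) w) c = length (takeWhile (\<lambda>e. e = c) w)"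
    by (induction w) auto
  ultimately show ?case using 2 by simp
qed simp

text \<open>
  Induction that peels off a maximal initial run. The remainder begins with the other letter, so the
  run does not merge with what follows and \<open>runs\<close> can be evaluated.
\<close>
lemma first_run_induct [case_names Nil run]:
  fixes w :: "bool list"
  assumes "P []"
    and "\<And>m b w. m > 0 \<Longrightarrow> w = [] \<or> hd w = (\<not> b) \<Longrightarrow> P w \<Longrightarrow> P (replicate m b @ w)"
  shows "P w"
proof (induction w rule: length_induct)
  case (1 w)
  show ?case
  proof (cases w)
    case Nil
    then show ?thesis using assms(1) by simp
  next
    case (Cons b v)
    let ?t = "takeWhile (\<lambda>e. e = b) w" and ?d = "dropWhile (\<lambda>e. e = b) w"
    define m where "m = length ?t"
    have "?t = replicate m b"
      unfolding m_def by (rule replicate_eqI) (auto dest: set_takeWhileD)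
    then have eq: "replicate m b @ ?d = w"
      using takeWhile_dropWhile_id[of "\<lambda>e. e = b" w] by simp
    have pos: "m > 0" using Cons by (simp add: m_def)
    have hd: "?d = [] \<or> hd ?d = (\<not> b)"
    proof (cases "?d = []")
      case False
      then have "hd ?d \<noteq> b" by (rule hd_dropWhile)
      then have "hd ?d = (\<not> b)" by (cases "hd ?d"; cases b) simp_all
      then show ?thesis ..
    qed simp
    have "length w = m + length ?d" using arg_cong[OF eq, of length] by simp
    with pos have "P ?d" using 1 by simp
    from assms(2)[OF pos hd this] show ?thesis using eq by simp
  qed
qed

lemma runs_first_run:
  fixes w :: "bool list"
  assumes "m > 0" "w = [] \<or> hd w = (\<not> b)"
  shows "runs b (replicate m b @ w) = m # runs b w"
    and "runs (\<not> b) (replicate m b @ w) = runs (\<not> b) w"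
proof -
  have "w = [] \<or> hd w \<noteq> b" using assms(2) by (cases b) auto
  then show "runs b (replicate m b @ w) = m # runs b w"
    by (rule runs_replicate_same[OF assms(1)])
  show "runs (\<not> b) (replicate m b @ w) = runs (\<not> b) w"
    by (rule runs_replicate_other) simp
qed

lemma alternating_word_runs:
  "w = [] \<or> hd w = b \<Longrightarrow> alternating_word b (runs b w) (runs (\<not> b) w) = w"
proof (induction w arbitrary: b rule: first_run_induct)
  case (run m c w)
  then have "c = b" by (cases m) auto
  note R = runs_first_run[OF run(1,2)]
  have "alternating_word (\<not> c) (runs (\<not> c) w) (runs c w) = w"
    using run.IH[of "\<not> c"] run(2) by simp
  then show ?case unfolding \<open>c = b\<close>[symmetric] R by simp
qed simp

lemma length_runs:
  "w = [] \<or> hd w = b \<Longrightarrow>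
    length (runs b w) = length (runs (\<not> b) w) \<or> length (runs b w) = Suc (length (runs (\<not> b) w))"
proof (induction w arbitrary: b rule: first_run_induct)
  case (run m c w)
  then have "c = b" by (cases m) auto
  note R = runs_first_run[OF run(1,2)]
  have "length (runs (\<not> c) w) = length (runs c w) \<or> length (runs (\<not> c) w) = Suc (length (runs c w))"
    using run.IH[of "\<not> c"] run(2) by simp
  then show ?case unfolding \<open>c = b\<close>[symmetric] R by auto
qed simp

lemma hd_alternating_word:
  "\<forall>u\<in>set us. u > 0 \<Longrightarrow> alternating_word b us vs = [] \<or> hd (alternating_word b us vs) = b"
  by (cases us) (auto simp: hd_append)

text \<open>
  All lengths have to be positive: an empty run would let its two neighbours merge into one.
\<close>
lemma runs_alternating_word:
  assumes "length us = length vs \<or> length us = Suc (length vs)"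
    and "\<forall>u\<in>set us. u > 0" and "\<forall>v\<in>set vs. v > 0"
  shows "runs b (alternating_word b us vs) = us \<and> runs (\<not> b) (alternating_word b us vs) = vs"
  using assms
proof (induction b us vs rule: alternating_word.induct)
  case (2 b u us vs)
  have "alternating_word (\<not> b) vs us = [] \<or> hd (alternating_word (\<not> b) vs us) = (\<not> b)"
    using 2(4) by (rule hd_alternating_word)
  note R = runs_first_run[OF _ this]
  have "runs (\<not> b) (alternating_word (\<not> b) vs us) = vs \<and> runs b (alternating_word (\<not> b) vs us) = us"
    using 2 by auto
  moreover have "u > 0" using 2(3) by simp
  ultimately show ?case by (simp add: R)
qed simp

section \<open>The exponent of q\<close>

text \<open>
  The number of pairs of a \<open>False\<close> and a later \<open>True\<close> in \<open>w\<close>, where \<open>w\<close> is thought of as preceded by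
  \<open>z\<close> further letters \<open>False\<close>.
\<close>
fun inversions :: "nat \<Rightarrow> bool list \<Rightarrow> nat" where
  "inversions z [] = 0"
| "inversions z (b # w) = (if b then z + inversions z w else inversions (Suc z) w)"

lemma inversions_replicate_True:
  "inversions z (replicate m True @ w) = m * z + inversions z w"
  by (induction m) auto

lemma inversions_replicate_False:
  "inversions z (replicate m False @ w) = inversions (z + m) w"
  by (induction m arbitrary: z) auto

lemma inversions_append:
  "inversions z (v @ w) = inversions z v + inversions (z + count_list v False) w"
  by (induction v arbitrary: z) auto

text \<open>
  The two words begin with different letters but call each other in the recursion, so both formulas
  are proved together. They differ in the failure runs that precede the \<open>j\<close>-th success run: a
  leading failure run adds one more.
\<close>
lemma inversions_alternating_word:
  "length xs = length ys \<or> length xs = Suc (length ys) \<Longrightarrow>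
    inversions z (alternating_word True xs ys) = (\<Sum>j<length xs. (z + sum_list (take j ys)) * xs ! j)"
  "length ys = length xs \<or> length ys = Suc (length xs) \<Longrightarrow>
    inversions z (alternating_word False ys xs) = (\<Sum>j<length xs. (z + sum_list (take (Suc j) ys)) * xs ! j)"
proof (induction "length xs + length ys" arbitrary: xs ys z rule: less_induct)
  case less
  {
    case 1
    show ?case
    proof (cases xs)
      case Nil
      then show ?thesis by simp
    next
      case (Cons x xs')
      then have "inversions z (alternating_word False ys xs') =
        (\<Sum>j<length xs'. (z + sum_list (take (Suc j) ys)) * xs' ! j)"
        using 1 by (intro less(2)) auto
      then show ?thesis using Cons
        by (simp add: inversions_replicate_True sum.lessThan_Suc_shift mult.commute del: sum.lessThan_Suc)
    qed
  next
    case 2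
    show ?case
    proof (cases ys)
      case Nil
      then show ?thesis using 2 by simp
    next
      case (Cons y ys')
      then have "inversions (z + y) (alternating_word True xs ys') =
        (\<Sum>j<length xs. (z + y + sum_list (take j ys')) * xs ! j)"
        using 2 by (intro less(1)) auto
      then show ?thesis using Cons
        by (simp add: inversions_replicate_False add.assoc)
    qed
  }
qed

section \<open>Longest runs\<close>

text \<open>
  A block of \<open>k\<close> equal letters cannot straddle the boundary between the first run and the remainder,
  because the letter changes there. So it lies within one run.
\<close>
lemma long_run_iff:
  fixes w :: "bool list"
  assumes "k > 0"
  shows "(\<exists>a. a + k \<le> length w \<and> (\<forall>j<k. w ! (a + j) = b)) \<longleftrightarrow> (\<exists>r\<in>set (runs b w). k \<le> r)"
proof (induction w rule: first_run_induct)
  case Nil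
  then show ?case using assms by simp
next
  case (run m c w)
  let ?L = "\<lambda>w. \<exists>a. a + k \<le> length w \<and> (\<forall>j<k. w ! (a + j) = b)"
  let ?v = "replicate m c @ w"
  have "?L ?v \<longleftrightarrow> (c = b \<and> k \<le> m) \<or> ?L w"
  proof
    assume "?L ?v"
    then obtain a where a: "a + k \<le> m + length w" "\<And>j. j < k \<Longrightarrow> ?v ! (a + j) = b" by auto
    show "(c = b \<and> k \<le> m) \<or> ?L w"
    proof (cases "a < m")
      case True
      then have c: "c = b" using a(2)[of 0] assms by (simp add: nth_append)
      have "k \<le> m"
      proof (rule ccontr)
        assume "\<not> k \<le> m"
        then have "?v ! m = b" "w \<noteq> []" using a(2)[of "m - a"] a(1) True by auto
        then show False using c run(2) by (simp add: nth_append hd_conv_nth)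
      qed
      with c show ?thesis by simp
    next
      case False
      have "w ! (a - m + j) = b" if "j < k" for j
        using a(2)[OF that] False by (simp add: nth_append)
      moreover have "a - m + k \<le> length w" using a(1) False by simp
      ultimately show ?thesis by blast
    qed
  next
    assume "(c = b \<and> k \<le> m) \<or> ?L w"
    then show "?L ?v"
    proof
      assume "c = b \<and> k \<le> m"
      then show ?thesis by (intro exI[of _ 0]) (simp add: nth_append)
    next
      assume "?L w"
      then obtain a where a: "a + k \<le> length w" "\<And>j. j < k \<Longrightarrow> w ! (a + j) = b" by auto
      then show ?thesis by (intro exI[of _ "m + a"]) (auto simp: nth_append)
    qed
  qed
  moreover have "(\<exists>r\<in>set (runs b ?v). k \<le> r) \<longleftrightarrow> (c = b \<and> k \<le> m) \<or> (\<exists>r\<in>set (runs b w). k \<le> r)"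
  proof (cases "c = b")
    case True
    then show ?thesis using runs_first_run(1)[OF run(1,2)] by auto
  next
    case False
    then show ?thesis using runs_replicate_other[of c b m w] by auto
  qed
  ultimately show ?case using run.IH by simp
qed

text \<open>
  A block may be shortened, so every number below the maximal block length is itself a block length.
\<close>
lemma le_longest_run_iff:
  "k \<le> longest_run b n x \<longleftrightarrow> (\<exists>a. a + k \<le> n \<and> (\<forall>j\<in>{a+1..a+k}. x j = b))"
proof -
  let ?S = "{l. \<exists>a. a + l \<le> n \<and> (\<forall>j\<in>{a+1..a+l}. x j = b)}"
  have fin: "finite ?S" by (rule finite_subset[of _ "{..n}"]) auto
  have "0 \<in> ?S" by auto
  then have ne: "?S \<noteq> {}" by blast
  show ?thesis
  proof
    assume k: "k \<le> longest_run b n x"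
    have "longest_run b n x \<in> ?S" unfolding longest_run_def by (rule Max_in[OF fin ne])
    then obtain a where "a + longest_run b n x \<le> n" "\<forall>j\<in>{a+1..a+longest_run b n x}. x j = b" by blast
    with k show "\<exists>a. a + k \<le> n \<and> (\<forall>j\<in>{a+1..a+k}. x j = b)"
      by (intro exI[of _ a]) auto
  next
    assume "\<exists>a. a + k \<le> n \<and> (\<forall>j\<in>{a+1..a+k}. x j = b)"
    then show "k \<le> longest_run b n x" unfolding longest_run_def
      by (intro Max_ge[OF fin]) auto
  qed
qed

lemma le_longest_run_iff_runs:
  assumes "k > 0" and x: "\<forall>l\<in>{1..length w}. x l = of_bool (w ! (l - 1))"
  shows "k \<le> longest_run (of_bool b) (length w) x \<longleftrightarrow> (\<exists>r\<in>set (runs b w). k \<le> r)"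
proof -
  have "(\<forall>j\<in>{a+1..a+k}. x j = of_bool b) \<longleftrightarrow> (\<forall>j<k. w ! (a + j) = b)" if "a + k \<le> length w" for a
  proof -
    have "{a+1..a+k} = (\<lambda>j. Suc (a + j)) ` {..<k}"
    proof (intro set_eqI iffI)
      fix j assume "j \<in> {a+1..a+k}"
      then show "j \<in> (\<lambda>j. Suc (a + j)) ` {..<k}" by (intro image_eqI[of _ _ "j - a - 1"]) auto
    qed auto
    moreover have "x (Suc (a + j)) = of_bool (w ! (a + j))" if "j < k" for j
      using x \<open>a + k \<le> length w\<close> that by auto
    ultimately show ?thesis by auto
  qed
  then show ?thesis unfolding le_longest_run_iff long_run_iff[OF assms(1), symmetric] by blast
qed

section \<open>The probability of a word\<close>

context q_success_process
begin

definition path_event :: "bool list \<Rightarrow> 'a set" where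
  "path_event w = {\<omega> \<in> space M. \<forall>l\<in>{1..length w}. X l \<omega> = of_bool (w ! (l - 1))}"

lemma event_trial_eq: "j \<ge> 1 \<Longrightarrow> {\<omega> \<in> space M. X j \<omega> = c} \<in> events"
proof -
  assume "j \<ge> 1"
  from measurable_sets[OF binary_valued[OF this], of "{c} \<inter> {0, 1}"]
  have "X j -` ({c} \<inter> {0, 1}) \<inter> space M \<in> events" by simp
  also have "X j -` ({c} \<inter> {0, 1}) \<inter> space M = {\<omega> \<in> space M. X j \<omega> = c}"
    using measurable_space[OF binary_valued[OF \<open>j \<ge> 1\<close>]] by auto
  finally show ?thesis .
qed

lemma path_event_in_events: "path_event w \<in> events"
  unfolding path_event_def
  by (rule sets.sets_Collect_finite_All) (auto intro: event_trial_eq)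

lemma path_event_snoc:
  "path_event (w @ [b]) = {\<omega> \<in> path_event w. X (Suc (length w)) \<omega> = of_bool b}"
proof -
  have "{1..length (w @ [b])} = insert (Suc (length w)) {1..length w}" by auto
  then show ?thesis unfolding path_event_def by (auto simp: nth_append)
qed

lemma card_zeros_eq_count_list:
  "card {l \<in> {1..<Suc (length w)}. of_bool (w ! (l - 1)) = (0::nat)} = count_list w False"
proof -
  have "{l \<in> {1..<Suc (length w)}. of_bool (w ! (l - 1)) = (0::nat)} =
      Suc ` {i. i < length w \<and> w ! i = False}" (is "?A = _")
  proof (intro set_eqI iffI)
    fix l assume "l \<in> ?A"
    then show "l \<in> Suc ` {i. i < length w \<and> w ! i = False}" by (intro image_eqI[of _ _ "l - 1"]) auto
  qed auto
  then show ?thesis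
    by (simp add: card_image count_list_eq_length_filter length_filter_conv_card)
qed

text \<open>
  This is the defining conditional probability, multiplied out. When the history \<open>w\<close> has probability
  zero, nothing is assumed about the next trial, but then both sides vanish.
\<close>
lemma prob_path_event_snoc:
  "prob (path_event (w @ [b])) = prob (path_event w) *
     (if b then \<theta> * q ^ count_list w False else 1 - \<theta> * q ^ count_list w False)"
proof (cases "prob (path_event w) = 0")
  case True
  have "prob (path_event (w @ [b])) \<le> prob (path_event w)"
    by (rule finite_measure_mono[OF _ path_event_in_events]) (auto simp: path_event_snoc)
  with True show ?thesis by (simp add: measure_le_0_iff)
next
  case False
  let ?x = "\<lambda>l. of_bool (w ! (l - 1)) :: nat"
  let ?j = "Suc (length w)"
  have ev: "{\<omega> \<in> space M. \<forall>l\<in>{1..<?j}. X l \<omega> = ?x l} = path_event w"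
    unfolding path_event_def by (simp add: atLeastLessThanSuc_atLeastAtMost)
  then have pos: "\<P>(\<omega> in M. \<forall>l\<in>{1..<?j}. X l \<omega> = ?x l) > 0"
    using False by (simp add: zero_less_measure_iff)
  have "\<P>(\<omega> in M. X ?j \<omega> = of_bool b \<bar> \<forall>l\<in>{1..<?j}. X l \<omega> = ?x l) =
      (if b then \<theta> * q ^ count_list w False else 1 - \<theta> * q ^ count_list w False)"
    using cond_failure[of ?j "Suc (count_list w False)" ?x] pos
      cond_success[of ?j "Suc (count_list w False)" ?x] card_zeros_eq_count_list[of w]
    by (cases b) auto
  moreover have "{\<omega> \<in> space M. X ?j \<omega> = of_bool b \<and> (\<forall>l\<in>{1..<?j}. X l \<omega> = ?x l)} = path_event (w @ [b])"
    unfolding path_event_snoc ev[symmetric] by auto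
  ultimately show ?thesis using False unfolding cond_prob_def ev by (simp add: field_simps)
qed

text \<open>
  Appending a success adds to the exponent of \<open>q\<close> the number of earlier failures, while appending
  a failure adds the next factor to the product.
\<close>
lemma prob_path_event:
  "prob (path_event w) = \<theta> ^ count_list w True *
     (\<Prod>j=1..count_list w False. 1 - \<theta> * q ^ (j - 1)) * q ^ inversions 0 w"
proof (induction w rule: rev_induct)
  case Nil
  show ?case by (simp add: path_event_def prob_space)
next
  case (snoc b w)
  then show ?case
    by (simp add: prob_path_event_snoc inversions_append power_add)
qed

text \<open>
  Every outcome in the sample space follows exactly one word, because the trials take values in
  \<open>{0, 1}\<close> everywhere, not just almost surely. So the event is the disjoint union of path events.
\<close>
lemma prob_word_property:
  assumes Q: "\<And>w x. length w = n \<Longrightarrow> \<forall>l\<in>{1..n}. x l = of_bool (w ! (l - 1)) \<Longrightarrow> Q x \<longleftrightarrow> R w"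
  shows "\<P>(\<omega> in M. Q (\<lambda>j. X j \<omega>)) = (\<Sum>w | length w = n \<and> R w. prob (path_event w))"
proof -
  let ?W = "{w. length w = n \<and> R w}"
  have fin: "finite ?W"
    by (rule finite_subset[OF _ finite_lists_length_eq[of "UNIV :: bool set" n]]) auto
  have "{\<omega> \<in> space M. Q (\<lambda>j. X j \<omega>)} = (\<Union>w\<in>?W. path_event w)"
  proof (intro set_eqI iffI)
    fix \<omega> assume \<omega>: "\<omega> \<in> {\<omega> \<in> space M. Q (\<lambda>j. X j \<omega>)}"
    define w where "w = map (\<lambda>l. X (Suc l) \<omega> = 1) [0..<n]"
    have "X l \<omega> \<in> {0, 1}" if "l \<in> {1..n}" for l
      using measurable_space[OF binary_valued[of l], of \<omega>] that \<omega> by auto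
    then have x: "\<forall>l\<in>{1..n}. X l \<omega> = of_bool (w ! (l - 1))"
      unfolding w_def by fastforce
    have len: "length w = n" by (simp add: w_def)
    have "R w" using Q[of w "\<lambda>j. X j \<omega>"] len x \<omega> by simp
    with x len \<omega> show "\<omega> \<in> (\<Union>w\<in>?W. path_event w)"
      by (auto simp: path_event_def)
  next
    fix \<omega> assume "\<omega> \<in> (\<Union>w\<in>?W. path_event w)"
    then obtain w where w: "length w = n" "R w" "\<omega> \<in> space M"
      "\<forall>l\<in>{1..n}. X l \<omega> = of_bool (w ! (l - 1))" unfolding path_event_def by auto
    then show "\<omega> \<in> {\<omega> \<in> space M. Q (\<lambda>j. X j \<omega>)}"
      using Q[of w "\<lambda>j. X j \<omega>"] by simp
  qed
  moreover have "disjoint_family_on path_event ?W"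
    unfolding disjoint_family_on_def
  proof (intro ballI impI)
    fix v w assume vw: "v \<in> ?W" "w \<in> ?W" "v \<noteq> w"
    then obtain i where "i < n" "v ! i \<noteq> w ! i" by (auto simp: list_eq_iff_nth_eq)
    then have "Suc i \<in> {1..n}" "(of_bool (v ! (Suc i - 1)) :: nat) \<noteq> of_bool (w ! (Suc i - 1))" by auto
    then show "path_event v \<inter> path_event w = {}"
      using vw unfolding path_event_def by fastforce
  qed
  ultimately show ?thesis
    using finite_measure_finite_Union[OF fin, of path_event] path_event_in_events by auto
qed

end

section \<open>Summation over run lengths\<close>

definition good_word :: "nat \<Rightarrow> nat \<Rightarrow> bool list \<Rightarrow> bool" where
  "good_word k1 \<kappa> w \<longleftrightarrow> (\<exists>r\<in>set (runs True w). k1 \<le> r) \<and> (\<forall>r\<in>set (runs False w). r < \<kappa>)"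

text \<open>
  The set \<open>tuples m a 0\<close> carries no condition on the maximum. For \<open>k1 = 1\<close> the existence of a run of
  length at least \<open>k1\<close> therefore has to come from \<open>m \<ge> 1\<close>.
\<close>
lemma runs_in_tuples_iff:
  assumes "m \<ge> 1" and "k1 \<ge> 1"
  shows "(runs True w, runs False w) \<in> tuples m a (k1 - 1) \<times> tuples_below \<kappa> r s \<longleftrightarrow>
     good_word k1 \<kappa> w \<and> count_list w True = m \<and> count_list w False = r \<and>
     length (runs True w) = a \<and> length (runs False w) = s"
proof -
  have long_if_1: "\<exists>r\<in>set (runs True w). k1 \<le> r" if "count_list w True = m" "k1 = 1"
  proof -
    have "runs True w \<noteq> []" using that assms(1) sum_list_runs[of True w] by auto
    then have "hd (runs True w) \<in> set (runs True w)" by simp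
    then show ?thesis using runs_pos[of "hd (runs True w)" True w] that(2) by (auto intro!: bexI[of _ "hd (runs True w)"])
  qed
  have "(\<exists>x\<in>set (runs True w). k1 \<le> x) \<longleftrightarrow> k1 - 1 = 0 \<or> (\<exists>x\<in>set (runs True w). k1 - 1 < x)"
    if "count_list w True = m"
  proof -
    have "k1 - 1 < x \<longleftrightarrow> k1 \<le> x" for x using assms(2) by linarith
    then show ?thesis using that assms(2) long_if_1 by (cases "k1 = 1") simp_all
  qed
  then show ?thesis
    unfolding tuples_def tuples_below_def good_word_def
    by (auto simp: sum_list_runs runs_pos)
qed

text \<open>
  A change of variables from words to pairs of run length lists. Fixing the first letter \<open>b\<close> makes
  \<open>w \<mapsto> (runs True w, runs False w)\<close> injective, and \<open>lengths\<close> is the condition under which lists of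
  these lengths alternate starting with \<open>b\<close>, so that every pair is attained.
\<close>
lemma sum_words_by_runs:
  fixes q :: real
  assumes "m \<ge> 1" and "k1 \<ge> 1"
    and lengths: "if b then a = s \<or> a = Suc s else s = a \<or> s = Suc a"
  shows "(\<Sum>w | good_word k1 \<kappa> w \<and> count_list w True = m \<and> count_list w False = r \<and>
            hd w = b \<and> length (runs True w) = a \<and> length (runs False w) = s. q ^ inversions 0 w) =
    (\<Sum>(xs, ys) \<in> tuples m a (k1 - 1) \<times> tuples_below \<kappa> r s.
        q ^ (\<Sum>j<a. sum_list (take (if b then j else Suc j) ys) * xs ! j))"
proof (rule sum.reindex_bij_witness[where
      i = "\<lambda>(xs, ys). if b then alternating_word True xs ys else alternating_word False ys xs"
      and j = "\<lambda>w. (runs True w, runs False w)"], goal_cases)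
  case (1 w)
  then show ?case using alternating_word_runs[of w b] by (cases b) auto
next
  case (2 w)
  then show ?case using runs_in_tuples_iff[OF assms(1,2), of w a \<kappa> r s] by auto
next
  case (3 p)
  then obtain xs ys where p: "p = (xs, ys)" "xs \<in> tuples m a (k1 - 1)" "ys \<in> tuples_below \<kappa> r s" by auto
  then show ?case
    using lengths runs_alternating_word[of xs ys True] runs_alternating_word[of ys xs False]
    by (auto simp: tuples_def tuples_below_def)
next
  case (4 p)
  then obtain xs ys where p: "p = (xs, ys)" "xs \<in> tuples m a (k1 - 1)" "ys \<in> tuples_below \<kappa> r s" by auto
  let ?w = "if b then alternating_word True xs ys else alternating_word False ys xs"
  have R: "runs True ?w = xs" "runs False ?w = ys"
    using p lengths runs_alternating_word[of xs ys True] runs_alternating_word[of ys xs False]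
    by (auto simp: tuples_def tuples_below_def)
  then have mem: "good_word k1 \<kappa> ?w \<and> count_list ?w True = m \<and> count_list ?w False = r \<and>
     length (runs True ?w) = a \<and> length (runs False ?w) = s"
    using runs_in_tuples_iff[OF assms(1,2), of ?w a \<kappa> r s] p by simp
  then have "?w \<noteq> []" using assms(1) by auto
  then have "hd ?w = b"
    using p hd_alternating_word[of xs True ys] hd_alternating_word[of ys False xs]
    by (cases b) (auto simp: tuples_def tuples_below_def)
  with mem show ?case using p(1) by simp
next
  case (5 w)
  then have "inversions 0 w = (\<Sum>j<a. sum_list (take (if b then j else Suc j) (runs False w)) * runs True w ! j)"
    using lengths alternating_word_runs[of w b]
      inversions_alternating_word(1)[of "runs True w" "runs False w" 0]
      inversions_alternating_word(2)[of "runs False w" "runs True w" 0]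
    by (cases b) auto
  then show ?case by simp
qed

text \<open>
  With \<open>s\<close> failure runs there are four types of words, given by the first letter and the number of
  success runs: \<open>s\<close> or \<open>s - 1\<close> after an initial failure, \<open>s + 1\<close> or \<open>s\<close> after an initial success.
\<close>
lemma sum_good_words:
  fixes q :: real
  assumes "m \<ge> 1" and "k1 \<ge> 1" and "i \<ge> 1"
  shows "(\<Sum>w | good_word k1 \<kappa> w \<and> count_list w True = m \<and> count_list w False = i. q ^ inversions 0 w) =
    (\<Sum>s=1..i. H_sum q k1 \<kappa> m i s + O_sum q k1 \<kappa> m i s + G_sum q k1 \<kappa> m i (s + 1) + P_sum q k1 \<kappa> m i s)"
proof -
  let ?W = "{w. good_word k1 \<kappa> w \<and> count_list w True = m \<and> count_list w False = i}"
  define C where "C b a s = {w. good_word k1 \<kappa> w \<and> count_list w True = m \<and> count_list w False = i \<and>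
            hd w = b \<and> length (runs True w) = a \<and> length (runs False w) = s}" for b a s
  have fin: "finite ?W"
    by (rule finite_subset[OF _ finite_lists_length_eq[of "UNIV :: bool set" "m + i"]])
      (auto simp: length_eq_count_list)
  have finC: "finite (C b a s)" for b a s
    by (rule finite_subset[OF _ fin]) (auto simp: C_def)
  have block_count: "(\<lambda>w. length (runs False w)) ` ?W \<subseteq> {1..i}"
  proof (rule image_subsetI)
    fix w assume w: "w \<in> ?W"
    then have "runs False w \<noteq> []" using assms(3) sum_list_runs[of False w] by auto
    then have "1 \<le> length (runs False w)" by (cases "runs False w") auto
    moreover have "length xs \<le> sum_list xs" if "\<forall>x\<in>set xs. x > 0" for xs :: "nat list"
      using that by (induction xs) auto
    from this[of "runs False w"] have "length (runs False w) \<le> i"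
      using w by (simp add: sum_list_runs runs_pos)
    ultimately show "length (runs False w) \<in> {1..i}" by simp
  qed
  have "(\<Sum>w\<in>?W. q ^ inversions 0 w) = (\<Sum>s=1..i. \<Sum>w | w \<in> ?W \<and> length (runs False w) = s. q ^ inversions 0 w)"
    by (rule sum.group[OF fin _ block_count, symmetric]) simp
  also have "\<dots> = (\<Sum>s=1..i. H_sum q k1 \<kappa> m i s + O_sum q k1 \<kappa> m i s + G_sum q k1 \<kappa> m i (s + 1) + P_sum q k1 \<kappa> m i s)"
  proof (rule sum.cong[OF refl])
    fix s assume s: "s \<in> {1..i}"
    have "{w. w \<in> ?W \<and> length (runs False w) = s} =
        C False s s \<union> C False (s - 1) s \<union> C True (s + 1) s \<union> C True s s"
    proof (intro set_eqI iffI)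
      fix w assume "w \<in> {w. w \<in> ?W \<and> length (runs False w) = s}"
      then show "w \<in> C False s s \<union> C False (s - 1) s \<union> C True (s + 1) s \<union> C True s s"
        using length_runs[of w "hd w"] by (cases "hd w") (auto simp: C_def)
    qed (auto simp: C_def)
    then have "(\<Sum>w | w \<in> ?W \<and> length (runs False w) = s. q ^ inversions 0 w) =
        (\<Sum>w\<in>C False s s. q ^ inversions 0 w) + (\<Sum>w\<in>C False (s - 1) s. q ^ inversions 0 w) +
        (\<Sum>w\<in>C True (s + 1) s. q ^ inversions 0 w) + (\<Sum>w\<in>C True s s. q ^ inversions 0 w)"
    proof -
      (* Here s \<ge> 1 matters: s - 1 is then different from s, so the two types do not overlap. *)
      have "C False s s \<inter> C False (s - 1) s = {}"
        "(C False s s \<union> C False (s - 1) s) \<inter> C True (s + 1) s = {}"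
        "(C False s s \<union> C False (s - 1) s \<union> C True (s + 1) s) \<inter> C True s s = {}"
        using s by (auto simp: C_def)
      then show ?thesis
        unfolding \<open>{w. w \<in> ?W \<and> length (runs False w) = s} = _\<close>
        by (simp add: sum.union_disjoint finC)
    qed
    moreover have "(\<Sum>w\<in>C False s s. q ^ inversions 0 w) = H_sum q k1 \<kappa> m i s"
      unfolding C_def H_sum_def
      by (subst sum_words_by_runs[OF assms(1,2)]) (simp_all add: sum.atLeast1_atMost_eq)
    moreover have "(\<Sum>w\<in>C False (s - 1) s. q ^ inversions 0 w) = O_sum q k1 \<kappa> m i s"
      unfolding C_def O_sum_def using s
      by (subst sum_words_by_runs[OF assms(1,2)]) (simp_all add: sum.atLeast1_atMost_eq)
    (* The first success run has no failure before it, so the empty prefix sum at j = 1 may be added. *)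
    moreover have shift: "(\<Sum>j=2..a. sum_list (take (j - 1) ys) * xs ! (j - 1)) =
        (\<Sum>j<a. sum_list (take j ys) * xs ! j)" if "a \<ge> 1" for a and xs ys :: "nat list"
    proof -
      have "(\<Sum>j<a. sum_list (take j ys) * xs ! j) = (\<Sum>j=1..a. sum_list (take (j - 1) ys) * xs ! (j - 1))"
        by (simp add: sum.atLeast1_atMost_eq)
      also have "\<dots> = (\<Sum>j=2..a. sum_list (take (j - 1) ys) * xs ! (j - 1))"
        using that by (simp add: sum.atLeast_Suc_atMost numeral_2_eq_2)
      finally show ?thesis by simp
    qed
    moreover have "(\<Sum>w\<in>C True (s + 1) s. q ^ inversions 0 w) = G_sum q k1 \<kappa> m i (s + 1)"
      unfolding C_def G_sum_def
      by (subst sum_words_by_runs[OF assms(1,2)], simp, subst shift) simp_all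
    moreover have "(\<Sum>w\<in>C True s s. q ^ inversions 0 w) = P_sum q k1 \<kappa> m i s"
      unfolding C_def P_sum_def using s
      by (subst sum_words_by_runs[OF assms(1,2)], simp, subst shift) simp_all
    ultimately show "(\<Sum>w | w \<in> ?W \<and> length (runs False w) = s. q ^ inversions 0 w) =
       H_sum q k1 \<kappa> m i s + O_sum q k1 \<kappa> m i s + G_sum q k1 \<kappa> m i (s + 1) + P_sum q k1 \<kappa> m i s"
      by simp
  qed
  finally show ?thesis .
qed

section \<open>The joint distribution of the longest runs\<close>

theorem theorem7p3:
  fixes M :: "'a measure" and X :: "nat \<Rightarrow> 'a \<Rightarrow> nat"
    and q \<theta> :: real and k1 k2 n :: nat
  assumes "0 \<le> \<theta>" and "\<theta> \<le> 1" and "0 < q" and "q < 1"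
    and "q_success_process M q \<theta> X"
    and "k1 \<ge> 1" and "k2 \<ge> 1" and "n \<ge> k1"
  shows "\<P>(\<omega> in M. longest_run 1 n (\<lambda>j. X j \<omega>) \<ge> k1 \<and> longest_run 0 n (\<lambda>j. X j \<omega>) \<le> k2) =
    J_ind n (k1 + 1) *
      (\<Sum>i=1..n-k1. \<theta> ^ (n - i) * (\<Prod>j=1..i. 1 - \<theta> * q ^ (j - 1)) *
        (\<Sum>s=1..i. H_sum q k1 (k2 + 1) (n - i) i s
                 + O_sum q k1 (k2 + 1) (n - i) i s
                 + G_sum q k1 (k2 + 1) (n - i) i (s + 1)
                 + P_sum q k1 (k2 + 1) (n - i) i s))
    + J_ind n k1 * \<theta> ^ n"
proof -
  interpret q_success_process M q \<theta> X by fact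
  let ?good = "good_word k1 (k2 + 1)"
  let ?W = "{w :: bool list. length w = n \<and> ?good w}"
  let ?weight = "\<lambda>w. \<theta> ^ count_list w True *
     (\<Prod>j=1..count_list w False. 1 - \<theta> * q ^ (j - 1)) * q ^ inversions 0 w"
  have fin: "finite ?W"
    by (rule finite_subset[OF _ finite_lists_length_eq[of "UNIV :: bool set" n]]) auto
  have "\<P>(\<omega> in M. longest_run 1 n (\<lambda>j. X j \<omega>) \<ge> k1 \<and> longest_run 0 n (\<lambda>j. X j \<omega>) \<le> k2) =
      (\<Sum>w\<in>?W. prob (path_event w))"
  proof (rule prob_word_property)
    fix w and x :: "nat \<Rightarrow> nat" assume len: "length w = n" and x: "\<forall>l\<in>{1..n}. x l = of_bool (w ! (l - 1))"
    (* An upper bound on the longest run forbids the value k2 + 1, which is why k2 + 1 bounds the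
       failure runs strictly. *)
    have "longest_run 0 n x \<le> k2 \<longleftrightarrow> \<not> k2 + 1 \<le> longest_run 0 n x" by auto
    then show "longest_run 1 n x \<ge> k1 \<and> longest_run 0 n x \<le> k2 \<longleftrightarrow> ?good w"
      using le_longest_run_iff_runs[of k1 w x True] le_longest_run_iff_runs[of "k2 + 1" w x False]
        len x assms(6) by (auto simp: good_word_def not_le)
  qed
  also have "\<dots> = (\<Sum>w\<in>?W. ?weight w)" by (simp add: prob_path_event)
  also have "\<dots> = (\<Sum>i\<in>{0..n-k1}. \<Sum>w | w \<in> ?W \<and> count_list w False = i. ?weight w)"
  proof (rule sum.group[OF fin, symmetric])
    show "(\<lambda>w. count_list w False) ` ?W \<subseteq> {0..n-k1}"
    proof (rule image_subsetI)
      fix w assume w: "w \<in> ?W"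
      then obtain r where "r \<in> set (runs True w)" "k1 \<le> r" by (auto simp: good_word_def)
      then have "k1 \<le> count_list w True"
        using member_le_sum_list[of r "runs True w"] by (simp add: sum_list_runs)
      then show "count_list w False \<in> {0..n-k1}" using w length_eq_count_list[of w] by auto
    qed
  qed simp
  also have "\<dots> = (\<Sum>w | w \<in> ?W \<and> count_list w False = 0. ?weight w) +
      (\<Sum>i=1..n-k1. \<Sum>w | w \<in> ?W \<and> count_list w False = i. ?weight w)"
    by (simp add: sum.atLeast_Suc_atMost)
  also have "(\<Sum>w | w \<in> ?W \<and> count_list w False = 0. ?weight w) = \<theta> ^ n"
  proof -
    have "{w. w \<in> ?W \<and> count_list w False = 0} = {replicate n True}"
    proof (intro set_eqI iffI)
      fix w assume "w \<in> {w. w \<in> ?W \<and> count_list w False = 0}"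
      then have "length w = n" "False \<notin> set w" by (auto simp: count_list_0_iff)
      then show "w \<in> {replicate n True}"
        by (metis (full_types) replicate_eqI singletonI)
    next
      fix w assume "w \<in> {replicate n True}"
      moreover have "good_word k1 (k2 + 1) (replicate n True)"
        using runs_replicate_same[of n "[]" True] runs_replicate_other[of True False n "[]"] assms(6,8)
        by (simp add: good_word_def)
      ultimately show "w \<in> {w. w \<in> ?W \<and> count_list w False = 0}"
        by (auto simp: count_list_0_iff)
    qed
    moreover have "count_list (replicate n True) False = 0" by (simp add: count_list_0_iff)
    moreover have "inversions 0 (replicate n True) = 0"
      using inversions_replicate_True[of 0 n "[]"] by simp
    ultimately show ?thesis using length_eq_count_list[of "replicate n True"] by simp
  qed
  also have "(\<Sum>i=1..n-k1. \<Sum>w | w \<in> ?W \<and> count_list w False = i. ?weight w) =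
      (\<Sum>i=1..n-k1. \<theta> ^ (n - i) * (\<Prod>j=1..i. 1 - \<theta> * q ^ (j - 1)) *
        (\<Sum>s=1..i. H_sum q k1 (k2 + 1) (n - i) i s
                 + O_sum q k1 (k2 + 1) (n - i) i s
                 + G_sum q k1 (k2 + 1) (n - i) i (s + 1)
                 + P_sum q k1 (k2 + 1) (n - i) i s))"
  proof (rule sum.cong[OF refl])
    fix i assume i: "i \<in> {1..n-k1}"
    have "{w. w \<in> ?W \<and> count_list w False = i} =
        {w. ?good w \<and> count_list w True = n - i \<and> count_list w False = i}"
      using i assms(6) by (auto simp: length_eq_count_list)
    then have "(\<Sum>w | w \<in> ?W \<and> count_list w False = i. ?weight w) =
        (\<Sum>w | ?good w \<and> count_list w True = n - i \<and> count_list w False = i.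
           \<theta> ^ (n - i) * (\<Prod>j=1..i. 1 - \<theta> * q ^ (j - 1)) * q ^ inversions 0 w)"
      by (intro sum.cong) auto
    also have "\<dots> = \<theta> ^ (n - i) * (\<Prod>j=1..i. 1 - \<theta> * q ^ (j - 1)) *
        (\<Sum>w | ?good w \<and> count_list w True = n - i \<and> count_list w False = i. q ^ inversions 0 w)"
      by (simp add: sum_distrib_left)
    finally show "(\<Sum>w | w \<in> ?W \<and> count_list w False = i. ?weight w) =
        \<theta> ^ (n - i) * (\<Prod>j=1..i. 1 - \<theta> * q ^ (j - 1)) *
        (\<Sum>s=1..i. H_sum q k1 (k2 + 1) (n - i) i s
                 + O_sum q k1 (k2 + 1) (n - i) i s
                 + G_sum q k1 (k2 + 1) (n - i) i (s + 1)
                 + P_sum q k1 (k2 + 1) (n - i) i s)"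
      using i assms(6) by (subst (asm) sum_good_words) auto
  qed
  finally show ?thesis using assms(8)
    by (cases "n = k1") (simp_all add: J_ind_def)
qed

end
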